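(* Let $b\geq 2$ be an integer and let $M\in\mathcal{M}_b(\mathbf{P_1})$. Then the sequence $\{\|M^n\|\}_{n=1}^\infty$ obeys the following trichotomy: (1) $\{\|M^n\|\}_{n=1}^\infty$ tends to $\infty$ exponentially; or (2) $n+2\leq\|M^n\|\leq \binom{n+b}{n+1}$ for all $n\in\mathbb{N}$; or (3) $\|M^n\|\leq 2^{b-1}$ for all $n\in\mathbb{N}$.
   Context: $\mathbb{N}$ is the set of positive integers and $A=\{1,2,\dots,b\}$. For a real matrix $M=(M_{ij})$, $\|M\|=\sum_{i,j}|M_{ij}|$. $\mathcal{M}_b$ is the family of nonzero $b\times b$ matrices with entries in $\{0,1\}$; $r_i(M)$ and $c_j(M)$ denote the $i$-th row and $j$-th column of $M$. A matrix $M\in\mathcal{M}_b$ satisfies condition $\mathbf{P_1}$ if $r_i(M)\neq\mathbf{0}$ for every $i\in\{j\in A: c_j(M)\neq\mathbf{0}\}$; $\mathcal{M}_b(\mathbf{P_1})$ is the set of all $M\in\mathcal{M}_b$ satisfying $\mathbf{P_1}$. A sequence $\{a_n\}$ of positive numbers tends to $\infty$ exponentially if there are constants $c>0$ and $\lambda>1$ with $a_n\geq c\lambda^n$ for all $n\in\mathbb{N}$. *)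

theory Defs
  imports Complex_Main "Jordan_Normal_Form.Matrix"
begin

definition entry_norm :: "real mat \<Rightarrow> real" where
  "entry_norm M = (\<Sum>i<dim_row M. \<Sum>j<dim_col M. \<bar>M $$ (i, j)\<bar>)"

definition binary_matrices :: "nat \<Rightarrow> real mat set" where
  "binary_matrices b =
     {M \<in> carrier_mat b b. elements_mat M \<subseteq> {0, 1} \<and> M \<noteq> 0\<^sub>m b b}"

(* Rows and columns are indexed by {0..<b} instead of {1..b}. *)
definition P1 :: "nat \<Rightarrow> real mat \<Rightarrow> bool" where
  "P1 b M \<longleftrightarrow> (\<forall>i \<in> {j \<in> {0..<b}. col M j \<noteq> 0\<^sub>v b}. row M i \<noteq> 0\<^sub>v b)"

definition binary_matrices_P1 :: "nat \<Rightarrow> real mat set" where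
  "binary_matrices_P1 b = {M \<in> binary_matrices b. P1 b M}"

(* Sequences are indexed by the positive integers; the value at 0 is irrelevant.
   The positivity of the terms is part of the notion (and follows from the bound). *)
definition tends_to_infinity_exponentially :: "(nat \<Rightarrow> real) \<Rightarrow> bool" where
  "tends_to_infinity_exponentially a \<longleftrightarrow>
     (\<forall>n\<ge>1. a n > 0) \<and> (\<exists>c>0. \<exists>q>1. \<forall>n\<ge>1. a n \<ge> c * q ^ n)"

(* A trichotomy: at least one of the alternatives holds, and no two hold together. *)
definition trichotomy :: "bool \<Rightarrow> bool \<Rightarrow> bool \<Rightarrow> bool" where
  "trichotomy A B C \<longleftrightarrow>
     (A \<or> B \<or> C) \<and> \<not> (A \<and> B) \<and> \<not> (A \<and> C) \<and> \<not> (B \<and> C)"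

end

theory Submission
  imports Defs "HOL-Real_Asymp.Real_Asymp"
begin

text \<open>
  The norm of \<open>M ^\<^sub>m n\<close> counts the walks of length \<open>n\<close> in the digraph with adjacency matrix \<open>M\<close>;
  condition \<open>P1\<close> says that a walk of positive length can always be extended.
  If some vertex has two different successors in its own strongly connected component, two
  different closed walks of equal length through it can be concatenated freely, and growth is
  exponential. Otherwise each component is a single vertex or a cycle, so a walk is determined by
  the vertices through which it enters the components and the times it spends there, that is, by
  a multiset of \<open>n + 1\<close> vertices; this gives the binomial bound. If one cycle leads to another,
  then a vertex where the first is left has two successors, which yields at least one
  additional walk at each step. If no cycle leads to another, then by \<open>P1\<close> a walk never leaves a
  cycle it has entered, so a long walk is determined by the set of its entry vertices. This set
  contains exactly one vertex lying on a cycle, and there are at most \<open>2 ^ (b - 1)\<close> such sets.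
\<close>

section \<open>Paths and walks in a finite digraph\<close>

fun path :: "'a rel \<Rightarrow> 'a \<Rightarrow> 'a list \<Rightarrow> 'a \<Rightarrow> bool" where
  "path E x [] y \<longleftrightarrow> x = y"
| "path E x (z # zs) y \<longleftrightarrow> (x, z) \<in> E \<and> path E z zs y"

lemma path_append: "path E x (xs @ ys) y \<longleftrightarrow> (\<exists>z. path E x xs z \<and> path E z ys y)"
  by (induction xs arbitrary: x) auto

lemma path_end: "path E x xs y \<Longrightarrow> y = last (x # xs)"
  by (induction xs arbitrary: x) auto

lemma path_imp_rtrancl: "path E x xs y \<Longrightarrow> (x, y) \<in> E\<^sup>*"
  by (induction xs arbitrary: x) (auto intro: converse_rtrancl_into_rtrancl)

lemma rtrancl_imp_path: "(x, y) \<in> E\<^sup>* \<Longrightarrow> \<exists>xs. path E x xs y"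
proof (induction rule: converse_rtrancl_induct)
  case base
  have "path E y [] y" by simp
  then show ?case ..
next
  case (step x z)
  then obtain zs where "path E z zs y" by blast
  with step have "path E x (z # zs) y" by simp
  then show ?case ..
qed

lemma path_closed_set:
  "path E x xs y \<Longrightarrow> E \<subseteq> V \<times> V \<Longrightarrow> set xs \<subseteq> V"
  by (induction xs arbitrary: x) auto

text \<open>The start vertex is stored apart from the list, so the length of the list counts edges;
  the end vertex is determined by the pair (\<open>path_end\<close>).\<close>

definition walks :: "'a set \<Rightarrow> 'a rel \<Rightarrow> nat \<Rightarrow> ('a \<times> 'a list) set" where
  "walks V E n = {(x, xs). x \<in> V \<and> length xs = n \<and> (\<exists>y. path E x xs y)}"

definition cyclic :: "'a rel \<Rightarrow> 'a \<Rightarrow> bool" where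
  "cyclic E x \<longleftrightarrow> (x, x) \<in> E\<^sup>+"

text \<open>An edge whose head leads back to its tail stays inside a strongly connected component.
  So each component is a single vertex, with or without a loop, or a cycle.\<close>

definition deterministic_components :: "'a rel \<Rightarrow> bool" where
  "deterministic_components E \<longleftrightarrow> (\<forall>u v w. (u, v) \<in> E \<longrightarrow> (u, w) \<in> E \<longrightarrow>
     (v, u) \<in> E\<^sup>* \<longrightarrow> (w, u) \<in> E\<^sup>* \<longrightarrow> v = w)"

text \<open>The last conjunct puts \<open>u\<close> and \<open>v\<close> into different
  components.\<close>

definition linked_cycles :: "'a rel \<Rightarrow> bool" where
  "linked_cycles E \<longleftrightarrow>
     (\<exists>u v. cyclic E u \<and> cyclic E v \<and> (u, v) \<in> E\<^sup>* \<and> (v, u) \<notin> E\<^sup>*)"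

locale finite_digraph =
  fixes V :: "'a set" and E :: "'a rel"
  assumes finite_V: "finite V" and E_subset: "E \<subseteq> V \<times> V"
begin

lemma walk_snoc:
  assumes "(x, xs) \<in> walks V E n" "(last (x # xs), z) \<in> E"
  shows "(x, xs @ [z]) \<in> walks V E (Suc n)"
proof -
  have "path E x xs (last (x # xs))"
    using assms(1) path_end[of E x xs] by (auto simp: walks_def)
  then have "path E x (xs @ [z]) z" using assms(2) by (auto simp: path_append)
  then show ?thesis using assms(1) by (auto simp: walks_def)
qed

lemma finite_walks: "finite (walks V E n)"
proof (rule finite_subset)
  show "walks V E n \<subseteq> V \<times> {xs. set xs \<subseteq> V \<and> length xs = n}"
    using path_closed_set[OF _ E_subset] by (auto simp: walks_def)
  show "finite (V \<times> {xs. set xs \<subseteq> V \<and> length xs = n})"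
    by (simp add: finite_V finite_lists_length_eq)
qed

lemma cyclic_in_V: "cyclic E x \<Longrightarrow> x \<in> V"
  using E_subset trancl_subset_Sigma[of E V] unfolding cyclic_def by blast

end

subsection \<open>Growth\<close>

text \<open>This is \<open>P1\<close> in terms of edges. A vertex without incoming edges may still
  be a dead end, so extendability of walks is guaranteed from length 1 on only.\<close>

locale serial_digraph = finite_digraph +
  assumes serial: "(x, y) \<in> E \<Longrightarrow> \<exists>z. (y, z) \<in> E"
begin

text \<open>The chosen successor depends on the last vertex alone; \<open>linear_growth\<close> uses
  this to find a walk outside the image.\<close>

definition extend :: "'a \<times> 'a list \<Rightarrow> 'a \<times> 'a list" where
  "extend w = (fst w, snd w @ [SOME z. (last (fst w # snd w), z) \<in> E])"

lemma inj_extend: "inj_on extend A"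
  by (auto simp: inj_on_def extend_def)

lemma walk_end_has_successor:
  assumes "(x, xs) \<in> walks V E n" "n \<ge> 1"
  shows "\<exists>z. (last (x # xs), z) \<in> E"
proof -
  from assms obtain y where y: "path E x xs y" "length xs = n"
    by (auto simp: walks_def)
  with assms(2) obtain ys where xs: "xs = ys @ [y]"
    using path_end[OF y(1)] by (cases xs rule: rev_cases) auto
  with y(1) have "\<exists>u. (u, y) \<in> E" by (auto simp: path_append)
  with serial show ?thesis using path_end[OF y(1)] by blast
qed

lemma extend_walk:
  assumes "w \<in> walks V E n" "n \<ge> 1"
  shows "extend w \<in> walks V E (Suc n)"
proof -
  obtain x xs where w: "w = (x, xs)" by force
  have "(last (x # xs), SOME z. (last (x # xs), z) \<in> E) \<in> E"
    using walk_end_has_successor[of x xs n] assms w by (metis someI_ex)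
  then show ?thesis
    using walk_snoc assms(1) w by (simp add: extend_def)
qed

lemma card_walks_Suc: "n \<ge> 1 \<Longrightarrow> card (walks V E n) \<le> card (walks V E (Suc n))"
  by (rule card_inj_on_le[OF inj_extend _ finite_walks]) (use extend_walk in blast)

lemma card_walks_mono:
  assumes "1 \<le> m" "m \<le> n"
  shows "card (walks V E m) \<le> card (walks V E n)"
  using assms(2,1)
proof (induction rule: dec_induct)
  case (step n)
  then show ?case using card_walks_Suc[of n] by simp
qed simp

lemma card_walks_pos:
  assumes "E \<noteq> {}" "n \<ge> 1"
  shows "card (walks V E n) \<ge> 1"
proof -
  obtain x y where "(x, y) \<in> E" using assms(1) by auto
  then have "(x, [y]) \<in> walks V E 1" using E_subset by (auto simp: walks_def)
  then have "card (walks V E 1) \<ge> 1"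
    using finite_walks by (metis One_nat_def Suc_leI card_gt_0_iff empty_iff)
  then show ?thesis using card_walks_mono[of 1 n] assms(2) by simp
qed

lemma closed_path_power:
  assumes "path E u xs u"
  shows "\<exists>ys. path E u ys u \<and> length ys = k * length xs"
proof (induction k)
  case 0
  then show ?case by (intro exI[of _ "[]"]) simp
next
  case (Suc k)
  then obtain ys where "path E u ys u" "length ys = k * length xs" by blast
  then show ?case using assms by (intro exI[of _ "xs @ ys"]) (auto simp: path_append)
qed

text \<open>Two closed walks at \<open>u\<close> of equal length with different first steps can be
  concatenated in \<open>2 ^ k\<close> distinguishable ways.\<close>

lemma exponentially_many_walks:
  assumes "\<not> deterministic_components E"
  shows "\<exists>L\<ge>1. \<forall>k. 2 ^ k \<le> card (walks V E (k * L))"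
proof -
  from assms obtain u v w where uvw: "(u, v) \<in> E" "(u, w) \<in> E"
      "(v, u) \<in> E\<^sup>*" "(w, u) \<in> E\<^sup>*" "v \<noteq> w"
    unfolding deterministic_components_def by blast
  obtain vs ws where vs: "path E v vs u" and ws: "path E w ws u"
    using rtrancl_imp_path uvw(3,4) by metis
  let ?p = "length (v # vs)" and ?q = "length (w # ws)"
  define L where "L = ?p * ?q" \<comment> \<open>common length of the \<open>?q\<close>-fold and \<open>?p\<close>-fold closed walk\<close>
  \<comment> \<open>\<open>length ws\<close> further rounds after a first one make \<open>?q\<close>
    rounds of length \<open>?p\<close>. The first round is kept explicit because its first vertex,
    \<open>v\<close> or \<open>w\<close>, separates \<alpha> from \<beta>.\<close>
  obtain vs' where vs': "path E u vs' u" "length vs' = length ws * ?p"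
    using closed_path_power[of u "v # vs" "length ws"] vs uvw by auto
  obtain ws' where ws': "path E u ws' u" "length ws' = length vs * ?q"
    using closed_path_power[of u "w # ws" "length vs"] ws uvw by auto
  define \<alpha> \<beta> where "\<alpha> = v # vs @ vs'" and "\<beta> = w # ws @ ws'"
  have \<alpha>: "path E u \<alpha> u" "length \<alpha> = L"
    using uvw vs vs' by (auto simp: \<alpha>_def L_def path_append)
  have \<beta>: "path E u \<beta> u" "length \<beta> = L"
    using uvw ws ws' by (auto simp: \<beta>_def L_def path_append)
  define S where "S k = {xs. path E u xs u \<and> length xs = k * L}" for k
  have uV: "u \<in> V" using uvw E_subset by auto
  have S_walks: "Pair u ` S k \<subseteq> walks V E (k * L)" for k
    using uV by (auto simp: S_def walks_def)
  have fin: "finite (S k)" for k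
    using finite_subset[OF S_walks finite_walks] by (rule finite_imageD) (auto simp: inj_on_def)
  have card_S: "2 ^ k \<le> card (S k)" for k
  proof (induction k)
    case 0
    have "S 0 = {[]}" by (auto simp: S_def)
    then show ?case by simp
  next
    case (Suc k)
    have "(@) \<alpha> ` S k \<union> (@) \<beta> ` S k \<subseteq> S (Suc k)"
      using \<alpha> \<beta> by (auto simp: S_def path_append)
    moreover have "card ((@) \<alpha> ` S k \<union> (@) \<beta> ` S k) = card (S k) + card (S k)"
      using uvw(5) fin by (subst card_Un_disjoint) (auto simp: card_image inj_on_def \<alpha>_def \<beta>_def)
    ultimately have "2 * card (S k) \<le> card (S (Suc k))"
      using card_mono[OF fin] by (metis mult_2)
    then show ?case using Suc by simp
  qed
  have "card (S k) \<le> card (walks V E (k * L))" for k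
    by (rule card_inj_on_le[OF _ S_walks finite_walks]) (auto simp: inj_on_def)
  then have "\<forall>k. 2 ^ k \<le> card (walks V E (k * L))"
    using card_S le_trans by blast
  moreover have "L \<ge> 1" by (simp add: L_def)
  ultimately show ?thesis by blast
qed

lemma exponential_growth:
  assumes "\<not> deterministic_components E"
  shows "tends_to_infinity_exponentially (\<lambda>n. real (card (walks V E n)))"
proof -
  have "E \<noteq> {}" using assms by (auto simp: deterministic_components_def)
  then have pos: "card (walks V E n) \<ge> 1" if "n \<ge> 1" for n
    using card_walks_pos that by blast
  obtain L where L: "L \<ge> 1" "\<And>k. 2 ^ k \<le> card (walks V E (k * L))"
    using exponentially_many_walks[OF assms] by blast
  \<comment> \<open>Since n/L \<le> n div L + 1, the bound \<open>2 ^ (n div L)\<close> is at least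
    \<open>q ^ n / 2\<close>; the factor 1/2 pays for the rounding.\<close>
  define q where "q = 2 powr (1 / real L)"
  have "q > 1" using L(1) by (simp add: q_def)
  moreover have "1 / 2 * q ^ n \<le> real (card (walks V E n))" if "n \<ge> 1" for n
  proof -
    have "2 ^ (n div L) \<le> card (walks V E n)"
    \<comment> \<open>\<open>card_walks_mono\<close> starts at length 1, so lengths below
      \<open>L\<close> are treated apart.\<close>
    proof (cases "n div L = 0")
      case True
      then show ?thesis using pos[OF that] by simp
    next
      case False
      then have "1 \<le> n div L * L" using L(1) by simp
      then show ?thesis
        using L(2)[of "n div L"] card_walks_mono[of "n div L * L" n] by simp
    qed
    then have *: "2 ^ (n div L) \<le> real (card (walks V E n))"
      by (metis of_nat_le_iff of_nat_numeral of_nat_power)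
    have "real n \<le> (real (n div L) + 1) * real L"
    proof -
      have "n < Suc (n div L) * L"
        using dividend_less_div_times[of L n] L(1) by simp
      then have "n \<le> (n div L + 1) * L" by simp
      then show ?thesis
        by (metis of_nat_1 of_nat_add of_nat_le_iff of_nat_mult)
    qed
    then have "real n / real L \<le> real (n div L) + 1"
      using L(1) by (simp add: field_simps)
    then have "2 powr (real n / real L) \<le> 2 powr (real (n div L) + 1)"
      by simp
    also have "\<dots> = 2 * 2 ^ (n div L)"
      by (simp add: powr_add powr_realpow)
    finally have "q ^ n \<le> 2 * 2 ^ (n div L)"
      by (simp add: q_def powr_power)
    with * show ?thesis by linarith
  qed
  ultimately show ?thesis
    unfolding tends_to_infinity_exponentially_def using pos
    by (intro conjI exI[of _ "1/2"] exI[of _ q]) (auto intro: less_le_trans[of 0 1] simp: Suc_le_eq)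
qed

text \<open>\<open>extend\<close> embeds the walks of length m into those of length m + 1 and misses
  one, because some walk of length m ends at a vertex with two successors.\<close>

lemma linear_growth:
  assumes "linked_cycles E" "n \<ge> 1"
  shows "n + 2 \<le> card (walks V E n)"
proof -
  from assms obtain u v where uv: "cyclic E u" "cyclic E v" "(u, v) \<in> E\<^sup>*" "(v, u) \<notin> E\<^sup>*"
    unfolding linked_cycles_def by blast
  \<comment> \<open>\<open>(a, b)\<close> is the edge by which a path from \<open>u\<close> to
    \<open>v\<close> leaves the component of \<open>u\<close>.\<close>
  have "\<exists>a b. (u, a) \<in> E\<^sup>* \<and> (a, u) \<in> E\<^sup>* \<and> (a, b) \<in> E \<and> (b, u) \<notin> E\<^sup>*"
    using uv(3,4)
  proof (induction rule: rtrancl_induct)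
    case (step y z)
    then show ?case by (cases "(y, u) \<in> E\<^sup>*") blast+
  qed simp
  then obtain a b where ab: "(u, a) \<in> E\<^sup>*" "(a, u) \<in> E\<^sup>*" "(a, b) \<in> E" "(b, u) \<notin> E\<^sup>*"
    by blast
  \<comment> \<open>\<open>a\<close> shares its component with the cyclic \<open>u\<close>, so
    besides \<open>b\<close> it has a successor \<open>a'\<close> that leads back.\<close>
  have "(a, a) \<in> E\<^sup>+"
    using ab uv(1) unfolding cyclic_def by (meson rtrancl_trancl_trancl trancl_rtrancl_trancl)
  then obtain a' where a': "(a, a') \<in> E" "(a', a) \<in> E\<^sup>*"
    by (meson tranclD)
  have "a' \<noteq> b" using a' ab by (meson rtrancl_trans)
  obtain v' where v': "(v, v') \<in> E" using uv(2) unfolding cyclic_def by (meson tranclD)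
  have "v \<noteq> a" using uv ab by blast
  obtain as where as: "path E a' as a" using rtrancl_imp_path a' by metis
  \<comment> \<open>Go \<open>m\<close> times around a closed walk through \<open>a\<close> and keep
    the last \<open>m\<close> steps.\<close>
  have walk_to_a: "\<exists>x xs. (x, xs) \<in> walks V E m \<and> path E x xs a" for m
  proof -
    obtain ys where ys: "path E a ys a" "length ys = m * length (a' # as)"
      using closed_path_power[of a "a' # as" m] as a' by auto
    define zs ws where "zs = take (length ys - m) ys" and "ws = drop (length ys - m) ys"
    have "ys = zs @ ws" by (simp add: zs_def ws_def)
    then obtain x where x: "path E a zs x" "path E x ws a"
      using ys path_append by metis
    have "length ws = m" using ys(2) by (simp add: ws_def)
    moreover have "x \<in> V"
    proof -
      have "set zs \<subseteq> V" using path_closed_set[OF x(1) E_subset] .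
      moreover have "a \<in> V" using ab E_subset by auto
      ultimately show ?thesis
        using path_end[OF x(1)] last_in_set[of zs] by (cases "zs = []") auto
    qed
    ultimately show ?thesis using x by (auto simp: walks_def)
  qed
  have step: "Suc (card (walks V E m)) \<le> card (walks V E (Suc m))" if "m \<ge> 1" for m
  proof -
    obtain x xs where x: "(x, xs) \<in> walks V E m" "path E x xs a"
      using walk_to_a by blast
    \<comment> \<open>A successor of \<open>a\<close> other than the one that \<open>extend\<close>
      selects.\<close>
    define s where "s = (if (SOME z. (a, z) \<in> E) = b then a' else b)"
    have s: "(a, s) \<in> E" "s \<noteq> (SOME z. (a, z) \<in> E)"
      using ab a' \<open>a' \<noteq> b\<close> by (auto simp: s_def)
    have "(x, xs @ [s]) \<in> walks V E (Suc m)"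
      using walk_snoc[OF x(1)] s path_end[OF x(2)] by simp
    moreover have "(x, xs @ [s]) \<notin> extend ` walks V E m"
      using s path_end[OF x(2)] by (auto simp: extend_def)
    moreover have "card (extend ` walks V E m) = card (walks V E m)"
      by (rule card_image[OF inj_extend])
    moreover have "extend ` walks V E m \<subseteq> walks V E (Suc m)"
      using extend_walk that by blast
    ultimately show ?thesis
      using card_mono[OF finite_walks, of "insert (x, xs @ [s]) (extend ` walks V E m)" "Suc m"]
        finite_walks by simp
  qed
  show ?thesis using assms(2)
  proof (induction rule: dec_induct)
    case base
    \<comment> \<open>Two edges leave \<open>a\<close> and one leaves \<open>v\<close>, which
      differs from \<open>a\<close> because only \<open>a\<close> leads back to
      \<open>u\<close>.\<close>
    have "{(a, [a']), (a, [b]), (v, [v'])} \<subseteq> walks V E 1"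
      using ab a' v' E_subset by (auto simp: walks_def)
    then have "card {(a, [a']), (a, [b]), (v, [v'])} \<le> card (walks V E 1)"
      by (rule card_mono[OF finite_walks])
    then show ?case using \<open>a' \<noteq> b\<close> \<open>v \<noteq> a\<close> by simp
  next
    case (step m)
    then show ?case using \<open>\<And>m. m \<ge> 1 \<Longrightarrow> _\<close>[of m] by simp
  qed
qed

end

subsection \<open>Encoding walks by entry vertices\<close>

text \<open>Every vertex of a walk is replaced by the vertex through which the walk entered the current
  strongly connected component; \<open>e\<close> is the current entry vertex and \<open>x\<close> the current vertex.\<close>

fun entries :: "'a rel \<Rightarrow> 'a \<Rightarrow> 'a \<Rightarrow> 'a list \<Rightarrow> 'a list" where
  "entries E e x [] = []"
| "entries E e x (z # zs) =
     (let e' = if (z, x) \<in> E\<^sup>* then e else z in e' # entries E e' z zs)"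

lemma length_entries [simp]: "length (entries E e x xs) = length xs"
  by (induction xs arbitrary: e x) (auto simp: Let_def)

lemma set_entries: "set (entries E e x xs) \<subseteq> insert e (set xs)"
  by (induction xs arbitrary: e x) (fastforce simp: Let_def)+

text \<open>A repeated entry means that the walk stays in the component, where the successor is
  unique; a new entry is itself the next vertex. That \<open>e\<close> and \<open>x\<close> share a
  component is the invariant of the induction.\<close>

lemma entries_inject:
  assumes "deterministic_components E" "(e, x) \<in> E\<^sup>*" "(x, e) \<in> E\<^sup>*"
    and "path E x xs y" "path E x xs' y'" "entries E e x xs = entries E e x xs'"
  shows "xs = xs'"
  using assms(2-)
proof (induction xs arbitrary: e x xs')
  case Nil
  then show ?case using length_entries by (metis length_0_conv)
next
  case (Cons z zs)
  then obtain z' zs' where xs': "xs' = z' # zs'"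
    by (metis length_entries length_Suc_conv)
  have e: "(e, z) \<in> E\<^sup>*" "(e, z') \<in> E\<^sup>*"
    using Cons.prems xs' by (auto intro: rtrancl_into_rtrancl)
  have eq: "(if (z, x) \<in> E\<^sup>* then e else z) = (if (z', x) \<in> E\<^sup>* then e else z')"
    using Cons.prems(5) xs' by (simp add: Let_def)
  have "z = z' \<and> ((z, x) \<in> E\<^sup>* \<longleftrightarrow> (z', x) \<in> E\<^sup>*)"
  proof (cases "(z, x) \<in> E\<^sup>*"; cases "(z', x) \<in> E\<^sup>*")
    assume "(z, x) \<in> E\<^sup>*" "(z', x) \<in> E\<^sup>*"
    then show ?thesis
      using assms(1) Cons.prems(3,4) xs' unfolding deterministic_components_def by auto
  \<comment> \<open>If just one walk left the component, its next vertex would equal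
    \<open>e\<close>, which leads to \<open>x\<close>.\<close>
  qed (use eq Cons.prems(1) in auto)
  then show ?case
    using Cons.IH[of "if (z, x) \<in> E\<^sup>* then e else z" z zs'] Cons.prems xs' e
    by (auto simp: Let_def intro: rtrancl_trans split: if_splits)
qed

text \<open>Strict reachability between components, reflexive only at cyclic vertices: a list sorted
  by it can repeat only these.\<close>

definition before :: "'a rel \<Rightarrow> 'a \<Rightarrow> 'a \<Rightarrow> bool" where
  "before E x y \<longleftrightarrow> (x = y \<and> cyclic E x) \<or> ((x, y) \<in> E\<^sup>* \<and> (y, x) \<notin> E\<^sup>*)"

lemma transp_before: "transp (before E)"
  unfolding before_def by (rule transpI) (meson rtrancl_trans)

lemma before_antisym: "before E x y \<Longrightarrow> before E y x \<Longrightarrow> x = y"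
  by (auto simp: before_def)

text \<open>While the walk stays in a component, \<open>e\<close> is repeated and is cyclic; when it
  leaves, the new entry cannot lead back to \<open>e\<close>. Transitivity extends this from
  neighbours to all pairs.\<close>

lemma sorted_entries:
  assumes "(e, x) \<in> E\<^sup>*" "(x, e) \<in> E\<^sup>*" "path E x xs y"
  shows "sorted_wrt (before E) (e # entries E e x xs)"
proof -
  have "successively (before E) (e # entries E e x xs)"
    using assms
  proof (induction xs arbitrary: e x)
    case (Cons z zs)
    have e: "(e, z) \<in> E\<^sup>+" "path E z zs y"
      using Cons.prems by (auto intro: rtrancl_into_trancl1)
    show ?case
    proof (cases "(z, x) \<in> E\<^sup>*")
      case True
      then have "(z, e) \<in> E\<^sup>*" using Cons.prems by (meson rtrancl_trans)
      moreover have "before E e e"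
        using e calculation unfolding before_def cyclic_def
        by (meson trancl_rtrancl_trancl)
      ultimately show ?thesis
        using Cons.IH[of e z] e True by (simp add: trancl_into_rtrancl Let_def)
    next
      case False
      then have "before E e z"
        using e Cons.prems unfolding before_def by (meson rtrancl_trans trancl_into_rtrancl)
      then show ?thesis
        using Cons.IH[of z z] e False by (simp add: Let_def)
    qed
  qed simp
  then show ?thesis
    using successively_conv_sorted_wrt[OF transp_before] by blast
qed

text \<open>Each head occurs in the other list, so different heads would be related both
  ways.\<close>

lemma sorted_wrt_antisym_mset_eq:
  assumes "\<And>x y. R x y \<Longrightarrow> R y x \<Longrightarrow> x = y"
    and "sorted_wrt R xs" "sorted_wrt R ys" "mset xs = mset ys"
  shows "xs = ys"
  using assms(2-)
proof (induction xs arbitrary: ys)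
  case (Cons x xs)
  then obtain y ys' where ys: "ys = y # ys'" by (cases ys) auto
  have "x \<in> set ys" "y \<in> set (x # xs)"
    using Cons.prems(3) ys by (metis list.set_intros(1) set_mset_mset)+
  then have "x = y" using Cons.prems(1,2) ys assms(1) by auto
  then show ?case using Cons ys by auto
qed simp

definition encode :: "'a rel \<Rightarrow> 'a \<times> 'a list \<Rightarrow> 'a list" where
  "encode E w = fst w # entries E (fst w) (fst w) (snd w)"

lemma inj_on_encode:
  assumes "deterministic_components E"
  shows "inj_on (encode E) (walks V E n)"
proof (rule inj_onI)
  fix w w' assume w: "w \<in> walks V E n" "w' \<in> walks V E n" "encode E w = encode E w'"
  obtain x xs x' xs' where eq: "w = (x, xs)" "w' = (x', xs')" by force
  from w eq have "x' = x" by (simp add: encode_def)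
  with w eq entries_inject[OF assms, of x x xs _ xs'] show "w = w'"
    by (auto simp: encode_def walks_def)
qed

lemma sorted_encode: "w \<in> walks V E n \<Longrightarrow> sorted_wrt (before E) (encode E w)"
  using sorted_entries[of "fst w" "fst w" E "snd w"] by (auto simp: encode_def walks_def)

lemma length_encode: "w \<in> walks V E n \<Longrightarrow> length (encode E w) = Suc n"
  by (auto simp: encode_def walks_def)

lemma (in finite_digraph) set_encode:
  assumes "w \<in> walks V E n"
  shows "set (encode E w) \<subseteq> V"
proof -
  obtain y where "path E (fst w) (snd w) y" and "fst w \<in> V"
    using assms by (auto simp: walks_def)
  moreover from this have "set (snd w) \<subseteq> V"
    using path_closed_set[OF _ E_subset] by blast
  ultimately show ?thesis
    using set_entries[of E "fst w" "fst w" "snd w"] by (auto simp: encode_def)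
qed

subsection \<open>Upper bounds\<close>

text \<open>Codes are sorted, hence determined by their multiplicities. These form a vector of
  \<open>card V\<close> naturals with sum n + 1, counted by stars and bars.\<close>

lemma (in finite_digraph) card_walks_le_binomial:
  assumes "deterministic_components E" "V \<noteq> {}"
  shows "card (walks V E n) \<le> (n + card V) choose (n + 1)"
proof -
  obtain vs where vs: "distinct vs" "set vs = V"
    using finite_distinct_list[OF finite_V] by blast
  then have len: "length vs = card V" using distinct_card by fastforce
  define f where "f w = map (count_list (encode E w)) vs" for w
  let ?T = "{l. length l = card V \<and> sum_list l = n + 1}"
  have "inj_on f (walks V E n)"
  proof (rule inj_onI)
    fix w w' assume w: "w \<in> walks V E n" "w' \<in> walks V E n" "f w = f w'"
    have "count_list (encode E w) v = count_list (encode E w') v" for v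
    proof (cases "v \<in> V")
      case True
      then show ?thesis using w(3) vs by (auto simp: f_def)
    next
      case False
      then have "v \<notin> set (encode E w)" "v \<notin> set (encode E w')"
        using set_encode w by blast+
      then show ?thesis by (metis count_list_0_iff)
    qed
    then have "mset (encode E w) = mset (encode E w')"
      by (auto simp: multiset_eq_iff count_mset)
    then have "encode E w = encode E w'"
      using w(1,2) by (intro sorted_wrt_antisym_mset_eq[where R = "before E"])
        (auto intro: before_antisym sorted_encode)
    then show "w = w'"
      using inj_on_encode[OF assms(1)] w by (meson inj_onD)
  qed
  moreover have "f ` walks V E n \<subseteq> ?T"
    using len vs finite_V set_encode length_encode
    by (auto simp: f_def sum_list_distinct_conv_sum_set sum_count_set)
  moreover have "card ?T = (n + card V) choose (n + 1)"
    using card_length_sum_list[of "card V" "n + 1"] by simp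
  \<comment> \<open>The binomial coefficient is positive because \<open>V\<close> is nonempty, and a
    set of positive cardinality is finite.\<close>
  moreover have "finite ?T"
    using calculation(3) assms(2) finite_V by (intro card_ge_0_finite) (auto simp: card_gt_0_iff Suc_le_eq)
  ultimately show ?thesis using card_inj_on_le[of f "walks V E n" ?T] by simp
qed

section \<open>Bounded growth when no cycle leads to another\<close>

context serial_digraph
begin

text \<open>By seriality a path from \<open>y\<close> can be prolonged beyond \<open>card V\<close>
  steps; then it repeats a vertex.\<close>

lemma reaches_cyclic:
  assumes "(x, y) \<in> E"
  shows "\<exists>z. cyclic E z \<and> (y, z) \<in> E\<^sup>*"
proof -
  have "\<exists>ys z. length ys = n \<and> path E y ys z \<and> (\<exists>w. (z, w) \<in> E)" for n
  proof (induction n)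
    case 0
    then show ?case using serial[OF assms] by (intro exI[of _ "[]"]) auto
  next
    case (Suc n)
    then obtain ys z w where "length ys = n" "path E y ys z" "(z, w) \<in> E" by blast
    then show ?case using serial[of z w]
      by (intro exI[of _ "ys @ [w]"] exI[of _ w]) (auto simp: path_append)
  qed
  then obtain ys z where ys: "length ys = Suc (card V)" "path E y ys z" by blast
  have "\<not> distinct ys"
    using card_mono[OF finite_V path_closed_set[OF ys(2) E_subset]] ys(1) distinct_card[of ys]
    by auto
  then obtain as bs cs c where "ys = as @ [c] @ bs @ [c] @ cs"
    using not_distinct_decomp by blast
  \<comment> \<open>Both blocks end in \<open>c\<close>, so the second one is a closed path at
    \<open>c\<close>.\<close>
  then have "ys = (as @ [c]) @ (bs @ [c]) @ cs" by simp
  then obtain d e where "path E y (as @ [c]) d" "path E d (bs @ [c]) e"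
    using ys(2) by (metis path_append)
  then have c: "path E y (as @ [c]) c" "path E c (bs @ [c]) c"
    using path_end[of E y "as @ [c]" d] path_end[of E d "bs @ [c]" e] by auto
  have "cyclic E c"
    using c(2) path_imp_rtrancl[of E] unfolding cyclic_def
    by (auto simp: path_append intro: rtrancl_into_trancl1)
  then show ?thesis using path_imp_rtrancl[OF c(1)] by blast
qed

text \<open>If the path from \<open>x\<close> has an edge, \<open>y\<close> leads on to some cyclic
  vertex, which must lead back to \<open>x\<close> as cycles are not linked.\<close>

lemma cyclic_reaches_back:
  assumes "\<not> linked_cycles E" "cyclic E x" "(x, y) \<in> E\<^sup>*"
  shows "(y, x) \<in> E\<^sup>*"
  using assms(3)
proof (cases rule: rtranclE)
  case (step z)
  then obtain c where c: "cyclic E c" "(y, c) \<in> E\<^sup>*" using reaches_cyclic by blast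
  then have "(c, x) \<in> E\<^sup>*"
    using assms unfolding linked_cycles_def by (meson rtrancl_trans)
  with c show ?thesis by (meson rtrancl_trans)
qed simp

lemma before_not_linked:
  assumes "\<not> linked_cycles E" "before E x y"
  shows "x = y \<and> cyclic E x \<or> x \<noteq> y \<and> \<not> cyclic E x"
  using assms cyclic_reaches_back[OF assms(1), of x y] unfolding before_def by blast

text \<open>A non-cyclic vertex occurs once, and a cyclic vertex can be followed only by copies of
  itself, whose number the length fixes.\<close>

lemma sorted_before_set_eq:
  assumes "\<not> linked_cycles E" "sorted_wrt (before E) xs" "sorted_wrt (before E) ys"
    and "length xs = length ys" "set xs = set ys"
  shows "xs = ys"
  using assms(2-)
proof (induction xs arbitrary: ys)
  case (Cons x xs)
  then obtain y ys' where ys: "ys = y # ys'" by (cases ys) auto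
  have "x \<in> set ys" "y \<in> set (x # xs)"
    using Cons.prems(4) ys by auto
  then have y: "y = x" using Cons.prems(1,2) ys before_antisym[of E x y] by auto
  have *: "\<And>z. z \<in> set xs \<Longrightarrow> before E x z" "\<And>z. z \<in> set ys' \<Longrightarrow> before E x z"
    using Cons.prems ys y by auto
  show ?case
  proof (cases "cyclic E x")
    case True
    then have "\<forall>z\<in>set xs. z = x" "\<forall>z\<in>set ys'. z = x"
      using * before_not_linked[OF assms(1)] by blast+
    then have "xs = replicate (length xs) x" "ys' = replicate (length ys') x"
      by (simp_all add: replicate_length_same)
    then show ?thesis using ys y Cons.prems(3) by simp
  next
    case False
    then have "x \<notin> set xs" "x \<notin> set ys'"
      using * before_not_linked[OF assms(1)] by blast+
    then have "set xs = set ys'" using Cons.prems(4) ys y by auto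
    then show ?thesis using Cons ys y by auto
  qed
qed simp

lemma sorted_before_at_most_one_cyclic:
  assumes "\<not> linked_cycles E" "sorted_wrt (before E) xs"
    and "c \<in> set xs" "d \<in> set xs" "cyclic E c" "cyclic E d"
  shows "c = d"
  using assms(2-4)
proof (induction xs)
  case (Cons x xs)
  then show ?case using before_not_linked[OF assms(1)] assms(5,6) by (metis set_ConsD sorted_wrt.simps(2))
qed simp

lemma sorted_before_acyclic_distinct:
  assumes "sorted_wrt (before E) xs" "\<And>x. x \<in> set xs \<Longrightarrow> \<not> cyclic E x"
  shows "distinct xs"
  using assms by (induction xs) (auto simp: before_def)

lemma card_walks_le_power:
  assumes "deterministic_components E" "\<not> linked_cycles E" "E \<noteq> {}" "n \<ge> 1"
  shows "card (walks V E n) \<le> 2 ^ (card V - 1)"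
proof -
  \<comment> \<open>A code of length N + 1 > card V repeats a vertex, so it contains a cyclic one;
    monotonicity carries the bound back to \<open>n\<close>.\<close>
  define N where "N = n + card V"
  obtain c where c: "cyclic E c" using assms(3) reaches_cyclic by auto
  \<comment> \<open>Dropping \<open>c\<close> loses nothing: the set holds exactly one cyclic vertex, so \<open>c\<close> was present
    iff no cyclic vertex remains.\<close>
  define g where "g w = set (encode E w) - {c}" for w
  have "inj_on g (walks V E N)"
  proof (rule inj_onI)
    fix w w' assume w: "w \<in> walks V E N" "w' \<in> walks V E N" "g w = g w'"
    have "\<exists>d\<in>set (encode E v). cyclic E d" if "v \<in> walks V E N" for v
    proof (rule ccontr)
      assume "\<not> ?thesis"
      then have "distinct (encode E v)"
        using sorted_before_acyclic_distinct sorted_encode[OF that] by blast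
      then show False
        using card_mono[OF finite_V set_encode[OF that]] distinct_card length_encode[OF that]
        by (fastforce simp: N_def)
    qed
    then obtain d d' where d: "d \<in> set (encode E w)" "cyclic E d"
      "d' \<in> set (encode E w')" "cyclic E d'" using w by metis
    have one: "x = y" if "v \<in> walks V E N" "x \<in> set (encode E v)" "y \<in> set (encode E v)"
      "cyclic E x" "cyclic E y" for v x y
      using sorted_before_at_most_one_cyclic[OF assms(2) sorted_encode] that by blast
    have "c \<in> set (encode E w) \<longleftrightarrow> c \<in> set (encode E w')"
      using w(3) d c one[OF w(1), of c d'] one[OF w(2), of c d] unfolding g_def by blast
    then have "set (encode E w) = set (encode E w')"
      using w(3) unfolding g_def by blast
    then have "encode E w = encode E w'"
      using sorted_before_set_eq[OF assms(2)] sorted_encode length_encode w by metis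
    then show "w = w'" using inj_on_encode[OF assms(1)] w by (meson inj_onD)
  qed
  moreover have "g ` walks V E N \<subseteq> Pow (V - {c})"
    using set_encode unfolding g_def by blast
  ultimately have "card (walks V E N) \<le> card (Pow (V - {c}))"
    using finite_V by (intro card_inj_on_le) auto
  also have "\<dots> = 2 ^ (card V - 1)"
    using cyclic_in_V[OF c] finite_V by (simp add: card_Pow)
  finally show ?thesis
    using card_walks_mono[of n N] assms(4) by (simp add: N_def)
qed

end

subsection \<open>Matrix powers\<close>

definition edges :: "nat \<Rightarrow> real mat \<Rightarrow> nat rel" where
  "edges b M = {(i, j). i < b \<and> j < b \<and> M $$ (i, j) = 1}"

lemma finite_paths:
  assumes "E \<subseteq> V \<times> V" "finite V"
  shows "finite {xs. length xs = n \<and> path E i xs j}"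
proof (rule finite_subset)
  show "{xs. length xs = n \<and> path E i xs j} \<subseteq> {xs. set xs \<subseteq> V \<and> length xs = n}"
    using path_closed_set[OF _ assms(1)] by auto
  show "finite {xs. set xs \<subseteq> V \<and> length xs = n}"
    by (simp add: assms finite_lists_length_eq)
qed

text \<open>Splitting off the last vertex of a path matches the recursion of the matrix power, which
  multiplies by \<open>M\<close> on the right.\<close>

lemma pow_mat_entry:
  assumes M: "M \<in> carrier_mat b b" and bin: "\<And>i j. i < b \<Longrightarrow> j < b \<Longrightarrow> M $$ (i, j) \<in> {0, 1}"
    and "i < b" "j < b"
  shows "(M ^\<^sub>m n) $$ (i, j) = real (card {xs. length xs = n \<and> path (edges b M) i xs j})"
  using assms(4)
proof (induction n arbitrary: j)
  case 0
  have "{xs. length xs = 0 \<and> path (edges b M) i xs j} = (if i = j then {[]} else {})" by auto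
  then show ?case using M assms(3) 0 by simp
next
  case (Suc n)
  let ?E = "edges b M" and ?P = "\<lambda>n k. {xs. length xs = n \<and> path (edges b M) i xs k}"
  have fin: "finite (?P n k)" for n k
    by (rule finite_paths[where V = "{..<b}"]) (auto simp: edges_def)
  have eq: "?P (Suc n) j = (\<lambda>xs. xs @ [j]) ` (\<Union>k\<in>{k. (k, j) \<in> ?E}. ?P n k)"
  proof (intro equalityI subsetI)
    fix xs assume "xs \<in> ?P (Suc n) j"
    then show "xs \<in> (\<lambda>xs. xs @ [j]) ` (\<Union>k\<in>{k. (k, j) \<in> ?E}. ?P n k)"
      by (cases xs rule: rev_cases) (auto simp: path_append)
  qed (auto simp: path_append)
  have "card (?P (Suc n) j) = card (\<Union>k\<in>{k. (k, j) \<in> ?E}. ?P n k)"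
    unfolding eq by (rule card_image) (auto simp: inj_on_def)
  also have "\<dots> = (\<Sum>k\<in>{k. (k, j) \<in> ?E}. card (?P n k))"
  proof (rule card_UN_disjoint)
    show "finite {k. (k, j) \<in> ?E}"
      by (rule finite_subset[of _ "{..<b}"]) (auto simp: edges_def)
  qed (use fin in \<open>auto dest: path_end\<close>)
  finally have "real (card (?P (Suc n) j)) = (\<Sum>k\<in>{k. (k, j) \<in> ?E}. real (card (?P n k)))"
    by simp
  \<comment> \<open>The terms added for non-edges vanish, as \<open>M\<close> has entry 0
    there.\<close>
  also have "\<dots> = (\<Sum>k<b. (M ^\<^sub>m n) $$ (i, k) * M $$ (k, j))"
  proof (rule sum.mono_neutral_cong_left)
    show "\<forall>k\<in>{..<b} - {k. (k, j) \<in> ?E}. (M ^\<^sub>m n) $$ (i, k) * M $$ (k, j) = 0"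
      using bin Suc.prems by (force simp: edges_def)
  qed (auto simp: edges_def Suc)
  also have "\<dots> = (M ^\<^sub>m Suc n) $$ (i, j)"
    using M assms(3) Suc.prems pow_carrier_mat[OF M, of n]
    by (auto simp: scalar_prod_def atLeast0LessThan)
  finally show ?case by simp
qed

text \<open>Walks are sorted by start and end vertex; the absolute values disappear since the
  entries are cardinalities.\<close>

lemma entry_norm_pow_mat:
  assumes M: "M \<in> carrier_mat b b" and bin: "\<And>i j. i < b \<Longrightarrow> j < b \<Longrightarrow> M $$ (i, j) \<in> {0, 1}"
  shows "entry_norm (M ^\<^sub>m n) = real (card (walks {..<b} (edges b M) n))"
proof -
  let ?E = "edges b M" and ?P = "\<lambda>i k. {xs. length xs = n \<and> path (edges b M) i xs k}"
  have E: "?E \<subseteq> {..<b} \<times> {..<b}" by (auto simp: edges_def)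
  have fin: "finite (?P i k)" for i k by (rule finite_paths[OF E]) simp
  have "walks {..<b} ?E n = (SIGMA i:{..<b}. \<Union>j<b. ?P i j)"
  proof (intro equalityI subsetI)
    fix w assume "w \<in> walks {..<b} ?E n"
    then obtain i xs j where w: "w = (i, xs)" "i < b" "length xs = n" "path ?E i xs j"
      by (auto simp: walks_def)
    have "j < b"
      using path_end[OF w(4)] path_closed_set[OF w(4) E] w(2) last_in_set[of xs]
      by (cases "xs = []") (simp, fastforce)
    with w show "w \<in> (SIGMA i:{..<b}. \<Union>j<b. ?P i j)" by auto
  qed (auto simp: walks_def)
  then have "card (walks {..<b} ?E n) = (\<Sum>i<b. card (\<Union>j<b. ?P i j))"
    using fin by (simp add: card_SigmaI)
  also have "\<dots> = (\<Sum>i<b. \<Sum>j<b. card (?P i j))"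
    using fin by (intro sum.cong refl card_UN_disjoint) (auto dest: path_end)
  finally have "real (card (walks {..<b} ?E n)) = (\<Sum>i<b. \<Sum>j<b. real (card (?P i j)))"
    by simp
  moreover have "dim_row (M ^\<^sub>m n) = b" "dim_col (M ^\<^sub>m n) = b"
    using pow_carrier_mat[OF M, of n] by auto
  ultimately show ?thesis
    unfolding entry_norm_def by (simp only:) (intro sum.cong refl, simp add: pow_mat_entry[OF M bin])
qed

text \<open>The head of an edge has a nonzero column, so \<open>P1\<close> gives it a nonzero row,
  that is, an outgoing edge.\<close>

lemma serial_digraph_edges:
  assumes "M \<in> binary_matrices_P1 b"
  shows "serial_digraph {..<b} (edges b M)"
proof
  fix x y assume "(x, y) \<in> edges b M"
  then have xy: "x < b" "y < b" "M $$ (x, y) = 1" by (auto simp: edges_def)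
  have M: "M \<in> carrier_mat b b" "P1 b M" "elements_mat M \<subseteq> {0, 1}"
    using assms by (auto simp: binary_matrices_P1_def binary_matrices_def)
  have "col M y $ x = 1" using M xy by simp
  then have "col M y \<noteq> 0\<^sub>v b" using xy by auto
  then have "row M y \<noteq> 0\<^sub>v b" using M(2) xy by (auto simp: P1_def)
  then obtain z where "z < b" "M $$ (y, z) \<noteq> 0"
    using M(1) xy by (auto simp: vec_eq_iff)
  moreover from this have "M $$ (y, z) \<in> elements_mat M"
    using M(1) xy by auto
  ultimately show "\<exists>z. (y, z) \<in> edges b M"
    using M(3) xy by (auto simp: edges_def)
qed (auto simp: edges_def)

section \<open>Exclusiveness of the alternatives and the trichotomy\<close>

lemma exponential_not_polynomially_bounded:
  assumes "tends_to_infinity_exponentially a"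
  shows "\<not> (\<forall>n\<ge>1. a n \<le> real ((n + b) choose (n + 1)))"
proof
  assume bound: "\<forall>n\<ge>1. a n \<le> real ((n + b) choose (n + 1))"
  obtain c q where cq: "c > 0" "q > 1" "\<And>n. n \<ge> 1 \<Longrightarrow> c * q ^ n \<le> a n"
    using assms unfolding tends_to_infinity_exponentially_def by blast
  \<comment> \<open>By symmetry the lower index becomes b - 1, so for fixed \<open>b\<close> the
    bound is polynomial in \<open>n\<close>; the coarse degree \<open>b\<close> suffices against
    \<open>q ^ n\<close>.\<close>
  have le: "c * q ^ n \<le> (real n + real b) ^ b" if "n \<ge> 1" for n
  proof -
    have "(n + b) choose (n + 1) \<le> (n + b) ^ b"
    proof (cases "b = 0")
      case False
      then have "(n + b) choose (n + 1) = (n + b) choose (b - 1)"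
        by (subst binomial_symmetric) (auto intro!: arg_cong[where f = "binomial _"])
      also have "\<dots> \<le> (n + b) ^ (b - 1)"
        using False that by (intro binomial_le_pow) auto
      also have "\<dots> \<le> (n + b) ^ b"
        using False by (intro power_increasing) auto
      finally show ?thesis .
    qed (simp add: binomial_eq_0)
    then have "real ((n + b) choose (n + 1)) \<le> (real n + real b) ^ b"
      by (metis of_nat_add of_nat_le_iff of_nat_power)
    then show ?thesis using cq(3)[OF that] bound that by fastforce
  qed
  have "(\<lambda>n. (real n + real b) ^ b / q ^ n) \<longlonglongrightarrow> 0"
    using cq(2) by real_asymp
  then have "eventually (\<lambda>n. (real n + real b) ^ b / q ^ n < c) sequentially"
    using cq(1) by (rule order_tendstoD)
  then obtain N where N: "\<And>n. n \<ge> N \<Longrightarrow> (real n + real b) ^ b / q ^ n < c"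
    by (auto simp: eventually_sequentially)
  define n where "n = max N 1"
  have "(real n + real b) ^ b < c * q ^ n"
    using N[of n] cq(2) by (simp add: n_def pos_divide_less_eq)
  then show False using le[of n] by (simp add: n_def)
qed

theorem theorem1:
  fixes b :: nat and M :: "real mat"
  assumes "b \<ge> 2"
    and "M \<in> binary_matrices_P1 b"
  shows "trichotomy
    (tends_to_infinity_exponentially (\<lambda>n. entry_norm (M ^\<^sub>m n)))
    (\<forall>n\<ge>1. real (n + 2) \<le> entry_norm (M ^\<^sub>m n) \<and>
           entry_norm (M ^\<^sub>m n) \<le> real ((n + b) choose (n + 1)))
    (\<forall>n\<ge>1. entry_norm (M ^\<^sub>m n) \<le> 2 ^ (b - 1))"
proof -
  define E where "E = edges b M"
  have M: "M \<in> carrier_mat b b" "elements_mat M \<subseteq> {0, 1}" "M \<noteq> 0\<^sub>m b b"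
    using assms(2) by (auto simp: binary_matrices_P1_def binary_matrices_def)
  have bin: "M $$ (i, j) \<in> {0, 1}" if "i < b" "j < b" for i j
  proof -
    have "M $$ (i, j) \<in> elements_mat M" using M(1) that by auto
    then show ?thesis using M(2) by blast
  qed
  interpret serial_digraph "{..<b}" E
    unfolding E_def by (rule serial_digraph_edges[OF assms(2)])
  have "E \<noteq> {}"
  proof
    assume "E = {}"
    then have "M $$ (i, j) = 0" if "i < b" "j < b" for i j
      using bin[OF that] that by (auto simp: E_def edges_def)
    then have "M = 0\<^sub>m b b" using M(1) by (intro eq_matI) auto
    with M(3) show False ..
  qed
  let ?a = "\<lambda>n. real (card (walks {..<b} E n))"
  let ?exp = "tends_to_infinity_exponentially ?a"
  let ?poly = "\<forall>n\<ge>1. real (n + 2) \<le> ?a n \<and> ?a n \<le> real ((n + b) choose (n + 1))"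
  let ?bdd = "\<forall>n\<ge>1. ?a n \<le> 2 ^ (b - 1)"
  have norm: "entry_norm (M ^\<^sub>m n) = ?a n" for n
    unfolding E_def by (rule entry_norm_pow_mat[OF M(1) bin])
  have "?exp \<or> ?poly \<or> ?bdd"
  proof (cases "deterministic_components E")
    case False
    then show ?thesis using exponential_growth by blast
  next
    case det: True
    show ?thesis
    proof (cases "linked_cycles E")
      case True
      have "{..<b} \<noteq> {}" using assms(1) by (auto simp: lessThan_empty_iff)
      then have "real (n + 2) \<le> ?a n \<and> ?a n \<le> real ((n + b) choose (n + 1))" if "n \<ge> 1" for n
        using linear_growth[OF True that] card_walks_le_binomial[OF det, of n] by simp
      then show ?thesis by blast
    next
      case False
      have "?a n \<le> 2 ^ (b - 1)" if "n \<ge> 1" for n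
        using card_walks_le_power[OF det False \<open>E \<noteq> {}\<close> that]
        by (metis card_lessThan of_nat_le_iff of_nat_numeral of_nat_power)
      then show ?thesis by blast
    qed
  qed
  moreover have "\<not> (?exp \<and> ?poly)"
    using exponential_not_polynomially_bounded[of ?a b] by blast
  moreover have "\<not> (?exp \<and> ?bdd)"
  proof
    assume *: "?exp \<and> ?bdd"
    then obtain c q where cq: "c > 0" "q > 1" "\<And>n. n \<ge> 1 \<Longrightarrow> c * q ^ n \<le> ?a n"
      unfolding tends_to_infinity_exponentially_def by blast
    obtain n where "2 ^ (b - 1) / c < q ^ n" using real_arch_pow[OF cq(2)] by blast
    \<comment> \<open>\<open>n\<close> may be 0, whereas the bounds hold from index 1 on.\<close>
    also have "q ^ n \<le> q ^ Suc n" using cq(2) by (intro power_increasing) auto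
    finally have "2 ^ (b - 1) < c * q ^ Suc n" using cq(1) by (simp add: field_simps)
    also have "\<dots> \<le> ?a (Suc n)" by (rule cq(3)) simp
    also have "\<dots> \<le> 2 ^ (b - 1)" using * by simp
    finally show False by simp
  qed
  moreover have "\<not> (?poly \<and> ?bdd)"
  proof
    assume *: "?poly \<and> ?bdd"
    \<comment> \<open>The index n = \<open>2 ^ (b - 1)\<close> is admissible, and there n + 2
      exceeds the constant bound.\<close>
    have "(1::nat) \<le> 2 ^ (b - 1)" by simp
    then have "real (2 ^ (b - 1) + 2) \<le> 2 ^ (b - 1)"
      using * order_trans by blast
    then show False by simp
  qed
  ultimately show ?thesis
    unfolding trichotomy_def norm by blast
qed

end
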